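(* Let $\mathcal{H}$ be a separable Hilbert space, let $\{(\mathcal{W}_i,v_i)\}_{i\in I}$ be a fusion Bessel sequence in $\mathcal{H}$ with corresponding fusion frame operator $S_{\mathcal{W}}$, and let $K\in\mathcal{L}(\mathcal{H})$. Then $\{(\mathcal{W}_i,v_i)\}_{i\in I}$ is a $K$-fusion frame for $\mathcal{H}$ if and only if the quotient operator $\left[K^*/S_{\mathcal{W}}^{1/2}\right]$ is (well defined and) bounded.
   Context: The index set $I$ is finite or countable. $\mathcal{L}(\mathcal{H})$ is the space of bounded linear operators on $\mathcal{H}$; $N(T)$ and $R(T)$ denote null space and range; $P_{\mathcal{W}}$ denotes the orthogonal projection onto the closed subspace $\mathcal{W}$. Let $\{\mathcal{W}_i\}_{i\in I}$ be closed subspaces of $\mathcal{H}$ and $\{v_i\}_{i\in I}$ positive weights. $\{(\mathcal{W}_i,v_i)\}_{i\in I}$ is a fusion Bessel sequence in $\mathcal{H}$ if there is $B>0$ with $\sum_{i\in I}v_i^2\|P_{\mathcal{W}_i}f\|^2\le B\|f\|^2$ for all $f\in\mathcal{H}$; its fusion frame operator is the bounded positive operator $S_{\mathcal{W}}f=\sum_{i\in I}v_i^2P_{\mathcal{W}_i}f$, and $S_{\mathcal{W}}^{1/2}$ is its positive square root. It is a $K$-fusion frame for $\mathcal{H}$ if there are $A,B>0$ with $A\|K^*f\|^2\le\sum_{i\in I}v_i^2\|P_{\mathcal{W}_i}f\|^2\le B\|f\|^2$ for all $f\in\mathcal{H}$. Quotient operator: for $A,B\in\mathcal{L}(\mathcal{H})$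 with $N(B)\subset N(A)$, the quotient operator $[A/B]$ is the map $R(B)\to R(A)$ given by $Bx\mapsto Ax$. It is well defined exactly when $N(B)\subset N(A)$. *)

theory Defs
  imports "HOL-Analysis.Analysis"
begin

(* The scalar fields: real normed fields with a conjugation. By Ostrowski's theorem every
   real normed field is isometrically the real or the complex numbers, and mult_conj then
   forces conj to be the usual conjugation, so this class covers exactly the two standard cases. *)
class scalar_field = real_normed_field +
  fixes conj :: "'a \<Rightarrow> 'a"
  assumes conj_add: "conj (a + b) = conj a + conj b"
    and mult_conj: "a * conj a = scaleR ((norm a)\<^sup>2) 1"

instantiation real :: scalar_field
begin
definition conj_real :: "real \<Rightarrow> real" where "conj_real a = a"
instance by standard (simp_all add: conj_real_def power2_eq_square)
end

instantiation complex :: scalar_field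
begin
definition conj_complex :: "complex \<Rightarrow> complex" where "conj_complex = cnj"
instance
proof
  fix a b :: complex
  show "conj (a + b) = conj a + conj b"
    by (simp add: conj_complex_def)
  show "a * conj a = ((norm a)\<^sup>2) *\<^sub>R 1"
    unfolding conj_complex_def scaleR_conv_of_real mult_1_right
    by (rule complex_norm_square [symmetric])
qed
end

(* A Hilbert space over 'k. The type classes of 'a supply the complete metric and norm; smul and
   the 'k-valued inner product ip (linear in the first argument) are compatible with
   them. By polarization, ip x y + conj (ip x y) = of_real (2 * inner x y), so the
   real-valued inner of the class is necessarily the real part of ip, and every Hilbert space
   over the reals or the complex numbers is of this form. *)
locale hilbert_space = vector_space smul
  for smul :: "'k::scalar_field \<Rightarrow> 'a::{real_inner, complete_space} \<Rightarrow> 'a" +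
  fixes ip :: "'a \<Rightarrow> 'a \<Rightarrow> 'k"
  assumes smul_of_real: "smul (of_real r) x = r *\<^sub>R x"
    and ip_add_left: "ip (x + y) z = ip x z + ip y z"
    and ip_smul_left: "ip (smul c x) y = c * ip x y"
    and ip_commute: "ip y x = conj (ip x y)"
    and ip_self: "ip x x = of_real ((norm x)\<^sup>2)"

lemma hilbert_space_real:
  "hilbert_space scaleR (inner :: 'a::{real_inner, complete_space} \<Rightarrow> 'a \<Rightarrow> real)"
proof (intro hilbert_space.intro hilbert_space_axioms.intro)
  show "vector_space (scaleR :: real \<Rightarrow> 'a \<Rightarrow> 'a)"
    by unfold_locales (simp_all add: scaleR_add_right scaleR_add_left)
  show "inner y x = conj (inner x y)" for x y :: 'a
    unfolding conj_real_def by (rule inner_commute)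
qed (simp_all add: inner_add_left power2_norm_eq_inner)

lemma hilbert_space_complex:
  "hilbert_space (*) (\<lambda>x y::complex. x * cnj y)"
proof (intro hilbert_space.intro hilbert_space_axioms.intro)
  show "vector_space ((*) :: complex \<Rightarrow> complex \<Rightarrow> complex)"
    by unfold_locales (simp_all add: distrib_left distrib_right)
  show "x * cnj x = of_real ((norm x)\<^sup>2)" for x
    by (rule complex_norm_square [symmetric])
qed (simp_all add: conj_complex_def distrib_right scaleR_conv_of_real)

definition bounded_operator :: "('k::scalar_field \<Rightarrow> 'a \<Rightarrow> 'a) \<Rightarrow> ('a::real_normed_vector \<Rightarrow> 'a) \<Rightarrow> bool"
  where "bounded_operator smul T \<longleftrightarrow> Vector_Spaces.linear smul smul T \<and> bounded_linear T"

definition hilbert_adjoint :: "('a \<Rightarrow> 'a \<Rightarrow> 'k) \<Rightarrow> ('a \<Rightarrow> 'a) \<Rightarrow> 'a \<Rightarrow> 'a"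
  where "hilbert_adjoint ip T = (THE T'. \<forall>x y. ip (T x) y = ip x (T' y))"

(* Self-adjointness is part of positivity: over the reals it does not follow from the
   nonnegativity of the quadratic form, and without it square roots would not be unique. *)
definition positive_operator ::
  "('k::scalar_field \<Rightarrow> 'a \<Rightarrow> 'a) \<Rightarrow> ('a \<Rightarrow> 'a \<Rightarrow> 'k) \<Rightarrow> ('a::real_normed_vector \<Rightarrow> 'a) \<Rightarrow> bool"
  where "positive_operator smul ip T \<longleftrightarrow>
    bounded_operator smul T \<and> (\<forall>x y. ip (T x) y = ip x (T y)) \<and>
    (\<forall>x. \<exists>r\<ge>0. ip (T x) x = of_real r)"

definition positive_sqrt ::
  "('k::scalar_field \<Rightarrow> 'a \<Rightarrow> 'a) \<Rightarrow> ('a \<Rightarrow> 'a \<Rightarrow> 'k) \<Rightarrow> ('a::real_normed_vector \<Rightarrow> 'a) \<Rightarrow> 'a \<Rightarrow> 'a"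
  where "positive_sqrt smul ip T = (THE R. positive_operator smul ip R \<and> R \<circ> R = T)"

definition orth_proj :: "('a \<Rightarrow> 'a \<Rightarrow> 'k::zero) \<Rightarrow> 'a::ab_group_add set \<Rightarrow> 'a \<Rightarrow> 'a"
  where "orth_proj ip W f = (THE p. p \<in> W \<and> (\<forall>w\<in>W. ip (f - p) w = 0))"

definition weighted_closed_subspaces ::
  "('k::scalar_field \<Rightarrow> 'a \<Rightarrow> 'a) \<Rightarrow> 'i set \<Rightarrow> ('i \<Rightarrow> 'a::real_normed_vector set) \<Rightarrow> ('i \<Rightarrow> real) \<Rightarrow> bool"
  where "weighted_closed_subspaces smul I W v \<longleftrightarrow>
    (\<forall>i\<in>I. module.subspace smul (W i) \<and> closed (W i) \<and> v i > 0)"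

(* Since infsum of a non-summable family is 0, convergence has to be required separately in
   the two definitions below. *)
definition fusion_bessel ::
  "('k::scalar_field \<Rightarrow> 'a \<Rightarrow> 'a) \<Rightarrow> ('a \<Rightarrow> 'a \<Rightarrow> 'k) \<Rightarrow> 'i set \<Rightarrow> ('i \<Rightarrow> 'a::real_normed_vector set) \<Rightarrow> ('i \<Rightarrow> real) \<Rightarrow> bool"
  where "fusion_bessel smul ip I W v \<longleftrightarrow>
    weighted_closed_subspaces smul I W v \<and>
    (\<exists>B>0. \<forall>f.
       (\<lambda>i. (v i)\<^sup>2 * (norm (orth_proj ip (W i) f))\<^sup>2) summable_on I \<and>
       (\<Sum>\<^sub>\<infinity>i\<in>I. (v i)\<^sup>2 * (norm (orth_proj ip (W i) f))\<^sup>2) \<le> B * (norm f)\<^sup>2)"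

definition K_fusion_frame ::
  "('k::scalar_field \<Rightarrow> 'a \<Rightarrow> 'a) \<Rightarrow> ('a \<Rightarrow> 'a \<Rightarrow> 'k) \<Rightarrow> ('a \<Rightarrow> 'a) \<Rightarrow> 'i set \<Rightarrow> ('i \<Rightarrow> 'a::real_normed_vector set) \<Rightarrow> ('i \<Rightarrow> real) \<Rightarrow> bool"
  where "K_fusion_frame smul ip K I W v \<longleftrightarrow>
    weighted_closed_subspaces smul I W v \<and>
    (\<exists>A>0. \<exists>B>0. \<forall>f.
       (\<lambda>i. (v i)\<^sup>2 * (norm (orth_proj ip (W i) f))\<^sup>2) summable_on I \<and>
       A * (norm (hilbert_adjoint ip K f))\<^sup>2
         \<le> (\<Sum>\<^sub>\<infinity>i\<in>I. (v i)\<^sup>2 * (norm (orth_proj ip (W i) f))\<^sup>2) \<and>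
       (\<Sum>\<^sub>\<infinity>i\<in>I. (v i)\<^sup>2 * (norm (orth_proj ip (W i) f))\<^sup>2) \<le> B * (norm f)\<^sup>2)"

definition fusion_frame_operator ::
  "('a \<Rightarrow> 'a \<Rightarrow> 'k::zero) \<Rightarrow> 'i set \<Rightarrow> ('i \<Rightarrow> 'a::real_normed_vector set) \<Rightarrow> ('i \<Rightarrow> real) \<Rightarrow> 'a \<Rightarrow> 'a"
  where "fusion_frame_operator ip I W v f = (\<Sum>\<^sub>\<infinity>i\<in>I. (v i)\<^sup>2 *\<^sub>R orth_proj ip (W i) f)"

definition null_space :: "('a \<Rightarrow> 'b::zero) \<Rightarrow> 'a set"
  where "null_space T = {x. T x = 0}"

(* The quotient operator [A/B], to be used only on its domain range B and only if
   quotient_well_defined A B. *)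
definition quotient_operator :: "('a \<Rightarrow> 'b) \<Rightarrow> ('a \<Rightarrow> 'c) \<Rightarrow> 'c \<Rightarrow> 'b"
  where "quotient_operator A B y = (THE z. \<exists>x. y = B x \<and> z = A x)"

definition quotient_well_defined :: "('a \<Rightarrow> 'b::zero) \<Rightarrow> ('a \<Rightarrow> 'c::zero) \<Rightarrow> bool"
  where "quotient_well_defined A B \<longleftrightarrow> null_space B \<subseteq> null_space A"

lemma quotient_operator_apply:
  fixes A :: "'a::real_normed_vector \<Rightarrow> 'b::real_normed_vector"
    and B :: "'a \<Rightarrow> 'c::real_normed_vector"
  assumes "bounded_linear A" "bounded_linear B" "quotient_well_defined A B"
  shows "quotient_operator A B (B x) = A x"
  unfolding quotient_operator_def
proof (rule the_equality)
  fix z assume "\<exists>x'. B x = B x' \<and> z = A x'"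
  then obtain x' where x': "B x = B x'" "z = A x'" by blast
  have "B (x - x') = 0" using assms(2) x' by (simp add: linear_diff bounded_linear.linear)
  then have "A (x - x') = 0" using assms(3) by (auto simp: quotient_well_defined_def null_space_def)
  then show "z = A x" using assms(1) x' by (simp add: linear_diff bounded_linear.linear)
qed blast

definition bounded_map_on :: "'a::real_normed_vector set \<Rightarrow> ('a \<Rightarrow> 'b::real_normed_vector) \<Rightarrow> bool"
  where "bounded_map_on D T \<longleftrightarrow> (\<exists>C. \<forall>y\<in>D. norm (T y) \<le> C * norm y)"

end

theory Submission
  imports Defs
begin

text \<open>Since the square root \<open>R\<close> of the frame operator \<open>S\<close> is self-adjoint with \<open>R\<^sup>2 = S\<close>, the sum
  \<open>\<Sum> v\<^sub>i\<^sup>2 \<parallel>P\<^sub>i f\<parallel>\<^sup>2 = \<langle>S f, f\<rangle>\<close> equals \<open>\<parallel>R f\<parallel>\<^sup>2\<close>. The lower \<open>K\<close>-frame bound thus says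
  \<open>A \<parallel>K\<^sup>* f\<parallel>\<^sup>2 \<le> \<parallel>R f\<parallel>\<^sup>2\<close> for all \<open>f\<close>, which is boundedness of the map \<open>R f \<mapsto> K\<^sup>* f\<close>.
  Projections, adjoints and square roots are constructed for the real inner product, where the
  scalars act as bounded operators; a square root that commutes with everything commuting with \<open>S\<close>
  is then automatically linear over the scalar field.\<close>

section \<open>Projections and adjoints in a real Hilbert space\<close>

lemma norm_add_square:
  fixes x y :: "'a::real_inner"
  shows "(norm (x + y))\<^sup>2 = (norm x)\<^sup>2 + 2 * inner x y + (norm y)\<^sup>2"
  by (simp add: power2_norm_eq_inner inner_add inner_commute)

text \<open>Serves to show that two near-minimizers of the distance from \<open>f\<close> to a
  subspace are close: their midpoint lies in the subspace, so it cannot be nearer to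
  \<open>f\<close> than the infimum.\<close>

lemma parallelogram_midpoint:
  fixes f x y :: "'a::real_inner"
  shows "(norm (x - y))\<^sup>2 = 2 * (norm (f - x))\<^sup>2 + 2 * (norm (f - y))\<^sup>2
    - 4 * (norm (f - (1/2) *\<^sub>R (x + y)))\<^sup>2"
  by (simp add: power2_norm_eq_inner inner_add inner_diff inner_commute field_simps)

text \<open>For small \<open>t\<close> of sign opposite to \<open>a\<close>, the linear term
  outweighs the quadratic one. This is the first-order condition at a minimum, used below for
  nearest points and for zeros of semidefinite forms.\<close>

lemma quadratic_nonneg_imp_linear_zero:
  fixes a b :: real
  assumes "\<And>t. 0 \<le> t * (2 * a) + t\<^sup>2 * b"
  shows "a = 0"
proof (rule ccontr)
  assume "a \<noteq> 0"
  \<comment> \<open>Replacing \<open>b\<close> by a strictly positive upper bound makes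
    \<open>t = - a / M\<close> a legitimate choice for every sign of \<open>b\<close>.\<close>
  define M where "M = \<bar>b\<bar> + 1"
  have M: "M > 0" "b < M" by (auto simp: M_def)
  have "(- a / M) * (2 * a) + (- a / M)\<^sup>2 * b \<le> (- a / M) * (2 * a) + (- a / M)\<^sup>2 * M"
    using M by (intro add_left_mono mult_left_mono) auto
  also have "\<dots> = - a\<^sup>2 / M" using M by (simp add: power2_eq_square field_simps)
  also have "\<dots> < 0" using \<open>a \<noteq> 0\<close> M by simp
  finally show False using assms[of "- a / M"] by simp
qed

text \<open>The nearest point comes from Cantor's intersection theorem: the points of
  \<open>W\<close> whose squared distance from \<open>f\<close> is at most \<open>r n\<close> form
  nested nonempty closed sets with diameters tending to 0. Orthogonality is the first-order
  condition at this minimum.\<close>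

lemma closed_subspace_projection_ex:
  fixes W :: "'a::{real_inner, complete_space} set"
  assumes W: "subspace W" "closed W"
  obtains p where "p \<in> W" "\<And>w. w \<in> W \<Longrightarrow> inner (f - p) w = 0"
proof -
  define d where "d = infdist f W"
  have ne: "W \<noteq> {}" using subspace_0[OF W(1)] by blast
  have d0: "d \<ge> 0" by (simp add: d_def infdist_nonneg)
  have dle: "d \<le> norm (f - w)" if "w \<in> W" for w
    using infdist_le[OF that, of f] by (simp add: d_def dist_norm)
  define r where "r n = d\<^sup>2 + 1 / (real n + 1)" for n
  define C where "C n = W \<inter> cball f (sqrt (r n))" for n
  have mem: "x \<in> C n \<longleftrightarrow> x \<in> W \<and> (norm (f - x))\<^sup>2 \<le> r n" for x n
    using real_sqrt_le_iff[of "(norm (f - x))\<^sup>2" "r n"] by (simp add: C_def dist_norm)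
  obtain a where a: "\<And>n. a \<in> C n"
  proof (rule decreasing_closed_nest[of C])
    show "closed (C n)" for n unfolding C_def using W(2) by (intro closed_Int closed_cball)
    show "C n \<noteq> {}" for n
    proof -
      have "d < sqrt (r n)" using d0 by (intro real_less_rsqrt) (simp add: r_def)
      then obtain w where "w \<in> W" "dist f w < sqrt (r n)"
        using ne by (auto simp: d_def infdist_def cINF_less_iff split: if_splits)
      then show ?thesis by (auto simp: C_def less_imp_le)
    qed
    show "C n \<subseteq> C m" if "m \<le> n" for m n
    proof -
      have "r n \<le> r m" using that by (simp add: r_def frac_le)
      then show ?thesis using mem by fastforce
    qed
    fix e :: real assume e: "e > 0"
    obtain n where n: "4 / e\<^sup>2 < real n" using reals_Archimedean2 by blast
    have "dist x y < e" if xy: "x \<in> C n" "y \<in> C n" for x y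
    proof -
      \<comment> \<open>The midpoint is at distance at least \<open>d\<close>, so the parallelogram
        law leaves only the excess \<open>4 * (r n - d\<^sup>2)\<close>.\<close>
      have "(1/2) *\<^sub>R (x + y) \<in> W" using xy mem W(1) by (simp add: subspace_add subspace_scale)
      then have "d\<^sup>2 \<le> (norm (f - (1/2) *\<^sub>R (x + y)))\<^sup>2" using dle d0 by (intro power_mono) auto
      then have "(norm (x - y))\<^sup>2 \<le> 4 * r n - 4 * d\<^sup>2"
        using parallelogram_midpoint[of x y f] xy mem by (smt (verit))
      also have "\<dots> = 4 / (real n + 1)" by (simp add: r_def)
      also have "\<dots> < e\<^sup>2"
      proof -
        have "4 < e\<^sup>2 * real n" using n e by (simp add: field_simps)
        also have "\<dots> \<le> e\<^sup>2 * (real n + 1)" by (simp add: algebra_simps)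
        finally show ?thesis by (simp add: field_simps)
      qed
      finally show ?thesis using e by (simp add: dist_norm power_less_imp_less_base)
    qed
    then show "\<exists>n. \<forall>x\<in>C n. \<forall>y\<in>C n. dist x y < e" by blast
  qed blast
  have aW: "a \<in> W" using a mem by blast
  have "(\<lambda>n. r n) \<longlonglongrightarrow> d\<^sup>2 + 0"
    unfolding r_def using LIMSEQ_inverse_real_of_nat
    by (intro tendsto_add tendsto_const) (simp add: field_simps inverse_eq_divide)
  then have min: "(norm (f - a))\<^sup>2 \<le> d\<^sup>2"
    using a mem by (intro LIMSEQ_le_const[of r]) auto
  have "inner (f - a) w = 0" if w: "w \<in> W" for w
  proof (rule quadratic_nonneg_imp_linear_zero)
    fix t :: real
    have "a - t *\<^sub>R w \<in> W" using aW w W(1) by (simp add: subspace_diff subspace_scale)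
    then have "d\<^sup>2 \<le> (norm (f - (a - t *\<^sub>R w)))\<^sup>2" using dle d0 by (intro power_mono) auto
    moreover have "f - (a - t *\<^sub>R w) = (f - a) + t *\<^sub>R w" by simp
    ultimately have "(norm (f - a))\<^sup>2 \<le> (norm ((f - a) + t *\<^sub>R w))\<^sup>2"
      using min by (metis order_trans)
    then show "0 \<le> t * (2 * inner (f - a) w) + t\<^sup>2 * (norm w)\<^sup>2"
      by (simp add: norm_add_square power_mult_distrib)
  qed
  then show ?thesis using aW that by blast
qed

text \<open>The null space of \<open>g\<close> has codimension one unless \<open>g\<close> vanishes.
  Hence a vector \<open>z\<close> orthogonal to it determines \<open>g\<close> up to a factor, which
  is fixed by evaluating at \<open>z\<close>.\<close>

lemma riesz_representation:
  fixes g :: "'a::{real_inner, complete_space} \<Rightarrow> real"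
  assumes g: "bounded_linear g"
  obtains u where "\<And>x. g x = inner x u"
proof (cases "\<forall>x. g x = 0")
  case True
  then show ?thesis using that[of 0] by simp
next
  case False
  interpret g: bounded_linear g by fact
  obtain f where f: "g f \<noteq> 0" using False by blast
  let ?W = "g -` {0}"
  have "subspace ?W" by (simp add: subspace_def g.add g.scaleR g.zero)
  moreover have "closed ?W"
    by (intro continuous_closed_vimage) (auto intro: linear_continuous_at g)
  ultimately obtain p where p: "p \<in> ?W" "\<And>w. w \<in> ?W \<Longrightarrow> inner (f - p) w = 0"
    using closed_subspace_projection_ex by blast
  define z where "z = f - p"
  have gz: "g z \<noteq> 0" using f p by (simp add: z_def g.diff)
  then have z0: "z \<noteq> 0" using g.zero by auto
  have "g x = inner x ((g z / (norm z)\<^sup>2) *\<^sub>R z)" for x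
  proof -
    have "x - (g x / g z) *\<^sub>R z \<in> ?W" using gz by (simp add: g.diff g.scaleR)
    then have "inner z (x - (g x / g z) *\<^sub>R z) = 0" using p z_def by blast
    then have "inner x z = (g x / g z) * (norm z)\<^sup>2"
      by (simp add: inner_diff power2_norm_eq_inner inner_commute)
    then show ?thesis using gz z0 by simp
  qed
  then show ?thesis using that by blast
qed

lemma bounded_adjoint_ex:
  fixes T :: "'a::{real_inner, complete_space} \<Rightarrow> 'a"
  assumes T: "bounded_linear T"
  obtains T' where "bounded_linear T'" "\<And>x y. inner (T x) y = inner x (T' y)"
proof -
  have "\<exists>u. \<forall>x. inner (T x) y = inner x u" for y
  proof -
    have "bounded_linear (\<lambda>x. inner (T x) y)"
      using bounded_linear_compose[OF bounded_linear_inner_left T] .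
    then show ?thesis using riesz_representation by metis
  qed
  then obtain T' where T': "\<And>x y. inner (T x) y = inner x (T' y)" by metis
  obtain C where C: "C > 0" "\<And>x. norm (T x) \<le> norm x * C"
    using bounded_linear.pos_bounded[OF T] by blast
  have "bounded_linear T'"
  proof (rule bounded_linear_intro[where K = C])
    show "T' (x + y) = T' x + T' y" for x y
      by (rule vector_eq_ldot[THEN iffD1]) (simp add: inner_add flip: T')
    show "T' (r *\<^sub>R x) = r *\<^sub>R T' x" for r x
      by (rule vector_eq_ldot[THEN iffD1]) (simp flip: T')
    show "norm (T' y) \<le> norm y * C" for y
    proof (cases "T' y = 0")
      case False
      \<comment> \<open>Testing the adjoint relation at \<open>x = T' y\<close> bounds the square of
        the norm; one factor \<open>norm (T' y)\<close> is then cancelled, whence the case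
        distinction.\<close>
      have "norm (T' y) * norm (T' y) = inner (T (T' y)) y"
        by (simp add: T' power2_norm_eq_inner flip: power2_eq_square)
      also have "\<dots> \<le> norm (T (T' y)) * norm y" by (rule norm_cauchy_schwarz)
      also have "\<dots> \<le> (norm (T' y) * C) * norm y" using C by (intro mult_right_mono) auto
      finally show ?thesis using False by (simp add: mult_ac)
    qed (use C in simp)
  qed
  then show ?thesis using T' that by blast
qed

text \<open>The Cauchy criterion for unconditional sums: small tails of the scalar series
  \<open>g\<close> force small tails of \<open>f\<close>. It will turn the Bessel series into
  convergence of the frame operator.\<close>

lemma summable_on_if_norm_sum_square_le:
  fixes f :: "'i \<Rightarrow> 'a::{real_normed_vector, complete_space}" and g :: "'i \<Rightarrow> real"
  assumes g: "g summable_on A" and g0: "\<And>i. i \<in> A \<Longrightarrow> g i \<ge> 0" and B: "B > 0"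
    and le: "\<And>F. finite F \<Longrightarrow> F \<subseteq> A \<Longrightarrow> (norm (sum f F))\<^sup>2 \<le> B * sum g F"
  shows "f summable_on A"
proof -
  have "\<exists>P. eventually P (finite_subsets_at_top A) \<and>
      (\<forall>F F'. P F \<and> P F' \<longrightarrow> dist (sum f F) (sum f F') < e)" if "e > 0" for e
  proof -
    \<comment> \<open>Chosen so that \<open>B * d\<close> equals \<open>(e/2)\<^sup>2\<close>;
      approximating within \<open>d/2\<close> keeps the later inequality strict.\<close>
    define d where "d = (e/2)\<^sup>2 / B"
    have d: "d > 0" using \<open>e > 0\<close> B by (simp add: d_def)
    obtain F0 where F0: "finite F0" "F0 \<subseteq> A" "dist (sum g F0) (infsum g A) \<le> d/2"
      using infsum_finite_approximation[OF g, of "d/2"] d by auto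
    have *: "dist (sum f F) (sum f F0) < e/2" if F: "finite F" "F0 \<subseteq> F" "F \<subseteq> A" for F
    proof -
      have "sum g F \<le> infsum g A"
        using F g g0 by (intro finite_sum_le_infsum) auto
      then have "sum g (F - F0) \<le> d/2"
        using F F0 by (simp add: sum_diff dist_real_def abs_if split: if_splits)
      then have "sum g (F - F0) < d" using d by simp
      then have "B * sum g (F - F0) < (e/2)\<^sup>2"
        using B by (simp add: d_def field_simps)
      then have "(norm (sum f (F - F0)))\<^sup>2 < (e/2)\<^sup>2"
        using le[of "F - F0"] F by fastforce
      then have "norm (sum f (F - F0)) < e/2"
        by (rule power_less_imp_less_base) (use \<open>e > 0\<close> in simp)
      then show ?thesis using F by (simp add: sum_diff dist_norm)
    qed
    define P where "P F \<longleftrightarrow> finite F \<and> F0 \<subseteq> F \<and> F \<subseteq> A" for F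
    have "eventually P (finite_subsets_at_top A)"
      unfolding eventually_finite_subsets_at_top P_def using F0 by blast
    moreover have "dist (sum f F) (sum f F') < e" if "P F \<and> P F'" for F F'
      using dist_triangle_half_l[OF * *] that unfolding P_def by blast
    ultimately show ?thesis by blast
  qed
  then have "cauchy_filter (filtermap (sum f) (finite_subsets_at_top A))"
    by (simp add: cauchy_filter_metric_filtermap)
  moreover have "complete (UNIV::'a set)"
    by (meson Cauchy_convergent UNIV_I complete_def convergent_def)
  ultimately obtain L' where "(sum f \<longlongrightarrow> L') (finite_subsets_at_top A)"
    using complete_uniform[where S=UNIV] by (force simp add: filterlim_def)
  then show ?thesis
    using summable_on_def has_sum_def by blast
qed

section \<open>Square roots of semidefinite operators\<close>

text \<open>A zero of a nonnegative quadratic form is a minimum, so the derivative at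
  \<open>x\<close> in the direction \<open>T x\<close>, which is twice the square of the norm of
  \<open>T x\<close>, vanishes.\<close>

lemma semidefinite_eq_zero:
  fixes T :: "'a::real_inner \<Rightarrow> 'a"
  assumes T: "linear T" "\<And>x y. inner (T x) y = inner x (T y)" "\<And>x. 0 \<le> inner (T x) x"
    and x: "inner (T x) x = 0"
  shows "T x = 0"
proof -
  have "inner (T x) (T x) = 0"
  proof (rule quadratic_nonneg_imp_linear_zero)
    fix t :: real
    have "0 \<le> inner (T (x + t *\<^sub>R T x)) (x + t *\<^sub>R T x)" by (rule T)
    also have "\<dots> = inner (T x) x + t * (2 * inner (T x) (T x)) + t\<^sup>2 * inner (T (T x)) (T x)"
      using T(2)[of "T x" x]
      by (simp add: linear_add[OF T(1)] linear_scale[OF T(1)] inner_add power2_eq_square algebra_simps)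
    finally show "0 \<le> t * (2 * inner (T x) (T x)) + t\<^sup>2 * inner (T (T x)) (T x)"
      using x by simp
  qed
  then show ?thesis by simp
qed

text \<open>The quadratic form of \<open>T - T\<^sup>2 = T (1 - T) T + (1 - T) T (1 - T)\<close> is nonnegative.\<close>
lemma semidefinite_contraction:
  fixes T :: "'a::real_inner \<Rightarrow> 'a"
  assumes T: "linear T" "\<And>x y. inner (T x) y = inner x (T y)" "\<And>x. 0 \<le> inner (T x) x"
    and le: "\<And>x. inner (T x) x \<le> (norm x)\<^sup>2"
  shows "norm (T x) \<le> norm x"
proof -
  have "inner (T (T x)) (T x) \<le> inner (T x) (T x)"
    using le[of "T x"] by (simp add: power2_norm_eq_inner)
  moreover have "0 \<le> inner (T (x - T x)) (x - T x)" by (rule T)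
  moreover have "inner (T (x - T x)) (x - T x)
      = inner (T x) x - 2 * inner (T x) (T x) + inner (T (T x)) (T x)"
    using T(2)[of "T x" x] by (simp add: linear_diff[OF T(1)] inner_diff)
  ultimately have "(norm (T x))\<^sup>2 \<le> (norm x)\<^sup>2"
    using le[of x] by (simp add: power2_norm_eq_inner)
  then show ?thesis by (simp add: power2_le_iff_abs_le)
qed

text \<open>Polynomials in \<open>A\<close> with nonnegative coefficients, paired with their value at \<open>1\<close>.\<close>
inductive nonneg_poly :: "('a::real_inner \<Rightarrow> 'a) \<Rightarrow> ('a \<Rightarrow> 'a) \<Rightarrow> real \<Rightarrow> bool" for A where
  zero: "nonneg_poly A (\<lambda>x. 0) 0"
| base: "nonneg_poly A A 1"
| add: "nonneg_poly A S s \<Longrightarrow> nonneg_poly A T t \<Longrightarrow> nonneg_poly A (\<lambda>x. S x + T x) (s + t)"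
| mult: "nonneg_poly A S s \<Longrightarrow> nonneg_poly A T t \<Longrightarrow> nonneg_poly A (\<lambda>x. S (T x)) (s * t)"
| scale: "nonneg_poly A S s \<Longrightarrow> c \<ge> 0 \<Longrightarrow> nonneg_poly A (\<lambda>x. c *\<^sub>R S x) (c * s)"

lemma nonneg_poly_commute:
  assumes "nonneg_poly A T t" "linear B" "\<And>x. B (A x) = A (B x)"
  shows "B (T x) = T (B x)"
  using assms
proof (induction arbitrary: x)
qed (simp_all add: linear_0 linear_add linear_scale)

lemma nonneg_poly_linear: "nonneg_poly A T t \<Longrightarrow> linear A \<Longrightarrow> linear T"
proof (induction rule: nonneg_poly.induct)
  case (mult S s T t)
  then show ?case using linear_compose[of T S] by (simp add: comp_def)
qed (simp_all add: module_hom_zero linear_compose_add linear_compose_scale_right)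

lemma nonneg_poly_commute_poly:
  assumes "nonneg_poly A S s" "nonneg_poly A T t" "linear A"
  shows "S (T x) = T (S x)"
  using nonneg_poly_commute[of A T t S x] nonneg_poly_commute[of A S s A] nonneg_poly_linear assms
  by metis

text \<open>As no coefficient is negative, the triangle inequality bounds the polynomial at a
  contraction by its value at 1. This reduces convergence of operators to convergence of
  reals.\<close>

lemma nonneg_poly_bound:
  assumes "nonneg_poly A T t" "\<And>x. norm (A x) \<le> norm x"
  shows "0 \<le> t \<and> norm (T x) \<le> t * norm x"
  using assms
proof (induction arbitrary: x rule: nonneg_poly.induct)
  case (add S s T t)
  show ?case using add.IH(1)[of x] add.IH(2)[of x] add.prems norm_triangle_ineq[of "S x" "T x"]
    by (auto simp: distrib_right)
next
  case (mult S s T t)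
  have "norm (S (T x)) \<le> s * norm (T x)" using mult by blast
  also have "\<dots> \<le> s * (t * norm x)" using mult by (intro mult_left_mono) blast+
  finally show ?case using mult by (simp add: mult.assoc)
next
  case (scale S s c)
  then show ?case using mult_left_mono[of "norm (S x)" "s * norm x" c] by (simp add: mult.assoc)
qed auto

lemma nonneg_poly_symmetric:
  assumes "nonneg_poly A T t" "linear A" "\<And>x y. inner (A x) y = inner x (A y)"
  shows "inner (T x) y = inner x (T y)"
  using assms
proof (induction arbitrary: x y rule: nonneg_poly.induct)
  case (mult S s T t)
  \<comment> \<open>A product of symmetric operators is symmetric because the factors, both
    polynomials in \<open>A\<close>, commute.\<close>
  then show ?case using nonneg_poly_commute_poly[OF mult.hyps, of y] by simp
qed (simp_all add: inner_add)

text \<open>The solution of \<open>Y = (A + Y\<^sup>2) / 2\<close>, so that \<open>(1 - Y)\<^sup>2 = 1 - A\<close>. The iterates are polynomials in \<open>A\<close>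
  whose increments have nonnegative coefficients, hence they converge along with the scalar
  sequence obtained for \<open>A = 1\<close>.\<close>
lemma contraction_fixed_point:
  fixes A :: "'a::{real_inner, complete_space} \<Rightarrow> 'a"
  assumes A: "linear A" "\<And>x. norm (A x) \<le> norm x" "\<And>x y. inner (A x) y = inner x (A y)"
  obtains Y where "linear Y" "\<And>x. norm (Y x) \<le> norm x"
    "\<And>x y. inner (Y x) y = inner x (Y y)"
    "\<And>x. 2 *\<^sub>R Y x = A x + Y (Y x)"
    "\<And>B x. bounded_linear B \<Longrightarrow> (\<And>x. B (A x) = A (B x)) \<Longrightarrow> B (Y x) = Y (B x)"
proof -
  define y where "y n = rec_nat (\<lambda>x. 0) (\<lambda>n f x. (1/2) *\<^sub>R (A x + f (f x))) n" for n
  define t :: "nat \<Rightarrow> real" where "t n = rec_nat 0 (\<lambda>n r. (1/2) * (1 + r * r)) n" for n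
  have y0: "y 0 = (\<lambda>x. 0)" and yS: "y (Suc n) = (\<lambda>x. (1/2) *\<^sub>R (A x + y n (y n x)))" for n
    by (auto simp: y_def)
  have t0: "t 0 = 0" and tS: "t (Suc n) = (1/2) * (1 + t n * t n)" for n
    by (auto simp: t_def)
  have poly: "nonneg_poly A (y n) (t n)" for n
  proof (induction n)
    case 0
    show ?case using nonneg_poly.zero by (simp only: y0 t0)
  next
    case (Suc n)
    show ?case unfolding yS tS
      by (intro nonneg_poly.scale nonneg_poly.add nonneg_poly.base nonneg_poly.mult Suc) simp
  qed
  have lin: "linear (y n)" for n using nonneg_poly_linear poly A by blast
  have step: "nonneg_poly A (\<lambda>x. y (Suc n) x - y n x) (t (Suc n) - t n)" for n
  proof (induction n)
    case 0
    have "nonneg_poly A (\<lambda>x. (1/2) *\<^sub>R A x) (1/2 * 1)" by (intro nonneg_poly.intros) auto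
    then show ?case by (simp add: y0 t0 yS tS)
  next
    case (Suc n)
    \<comment> \<open>The difference of the squares of consecutive iterates is split as
      \<open>y' (y' - y) + (y' - y) y\<close>, with \<open>y'\<close> the later one. Both summands
      are products of polynomials already known to have nonnegative coefficients.\<close>
    have "nonneg_poly A (\<lambda>x. (1/2) *\<^sub>R (y (Suc n) (y (Suc n) x - y n x) + (y (Suc n) (y n x) - y n (y n x))))
      ((1/2) * (t (Suc n) * (t (Suc n) - t n) + (t (Suc n) - t n) * t n))"
      using nonneg_poly.mult[OF poly[of "Suc n"] Suc] nonneg_poly.mult[OF Suc poly[of n]]
      by (intro nonneg_poly.scale nonneg_poly.add) auto
    moreover have "(1/2) *\<^sub>R (y (Suc n) (y (Suc n) x - y n x) + (y (Suc n) (y n x) - y n (y n x)))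
      = y (Suc (Suc n)) x - y (Suc n) x" for x
      unfolding yS[of "Suc n"] by (subst (3) yS) (simp add: linear_diff[OF lin] algebra_simps)
    moreover have "(1/2) * (t (Suc n) * (t (Suc n) - t n) + (t (Suc n) - t n) * t n)
      = t (Suc (Suc n)) - t (Suc n)"
      unfolding tS[of "Suc n"] by (subst (6) tS) (simp add: algebra_simps)
    ultimately show ?case by (simp only:)
  qed
  have diff: "nonneg_poly A (\<lambda>x. y (n + k) x - y n x) (t (n + k) - t n)" for n k
  proof (induction k)
    case 0
    show ?case using nonneg_poly.zero by simp
  next
    case (Suc k)
    show ?case using nonneg_poly.add[OF step[of "n + k"] Suc] by simp
  qed
  have t1: "t n \<le> 1" for n
  proof (induction n)
    case (Suc n)
    have "0 \<le> t n" using nonneg_poly_bound poly A by blast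
    then have "t n * t n \<le> 1" using Suc mult_le_one by blast
    then show ?case by (simp add: tS)
  qed (simp add: t0)
  have "incseq t"
    using nonneg_poly_bound[OF step A(2)] by (intro incseq_SucI) simp
  then obtain l where l: "t \<longlonglongrightarrow> l"
    using incseq_convergent[of t 1] t1 by metis
  have "convergent (\<lambda>n. y n x)" for x
  proof (intro Cauchy_convergent metric_CauchyI)
    fix e :: real assume "e > 0"
    \<comment> \<open>The summand 1 avoids a division by zero at \<open>x = 0\<close>.\<close>
    then have e: "e / (norm x + 1) > 0" by (simp add: add_nonneg_pos)
    obtain N where N: "\<And>m n. m \<ge> N \<Longrightarrow> n \<ge> N \<Longrightarrow> dist (t m) (t n) < e / (norm x + 1)"
      using LIMSEQ_imp_Cauchy[OF l] e unfolding Cauchy_def by meson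
    have *: "dist (y n x) (y m x) < e" if nm: "N \<le> n" "n \<le> m" for m n
    proof -
      obtain k where k: "m = n + k" using nm le_Suc_ex by blast
      have "norm (y m x - y n x) \<le> (t m - t n) * norm x"
        using nonneg_poly_bound[OF diff A(2)] k by blast
      also have "\<dots> \<le> (t m - t n) * (norm x + 1)"
        using nonneg_poly_bound[OF diff A(2), of n k] k by (simp add: mult_left_mono)
      also have "\<dots> < e"
      proof -
        have "t m - t n < e / (norm x + 1)" using N[of m n] nm by (auto simp: dist_real_def)
        moreover have "norm x + 1 > 0" by (simp add: add_nonneg_pos)
        ultimately show ?thesis by (simp only: pos_less_divide_eq)
      qed
      finally show ?thesis by (simp add: dist_norm norm_minus_commute)
    qed
    show "\<exists>M. \<forall>m\<ge>M. \<forall>n\<ge>M. dist (y m x) (y n x) < e"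
      by (metis * dist_commute nle_le)
  qed
  then obtain Y where Y: "\<And>x. (\<lambda>n. y n x) \<longlonglongrightarrow> Y x" unfolding convergent_def by metis
  have bd: "norm (y n x) \<le> norm x" for n x
    using nonneg_poly_bound[OF poly A(2), of n x] t1[of n] mult_right_mono[of "t n" 1 "norm x"]
    by simp
  have linY: "linear Y"
  proof
    show "Y (a + b) = Y a + Y b" for a b
      using LIMSEQ_unique[OF Y[of "a + b"]] tendsto_add[OF Y[of a] Y[of b]]
      by (simp add: linear_add[OF lin])
    show "Y (r *\<^sub>R b) = r *\<^sub>R Y b" for r b
      using LIMSEQ_unique[OF Y[of "r *\<^sub>R b"]] tendsto_scaleR[OF tendsto_const Y[of b]]
      by (simp add: linear_scale[OF lin])
  qed
  have YY: "(\<lambda>n. y n (y n x)) \<longlonglongrightarrow> Y (Y x)" for x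
  proof -
    \<comment> \<open>Pointwise convergence passes to the composition because all \<open>y n\<close>
      are contractions.\<close>
    have "(\<lambda>n. y n (y n x - Y x)) \<longlonglongrightarrow> 0"
    proof (rule Lim_null_comparison)
      show "\<forall>\<^sub>F n in sequentially. norm (y n (y n x - Y x)) \<le> norm (y n x - Y x)" using bd by simp
      show "(\<lambda>n. norm (y n x - Y x)) \<longlonglongrightarrow> 0"
        using Y[of x] by (simp add: LIM_zero tendsto_norm_zero)
    qed
    from tendsto_add[OF this Y[of "Y x"]] show ?thesis by (simp add: linear_diff[OF lin])
  qed
  show ?thesis
  proof
    show "linear Y" by (rule linY)
    show "norm (Y x) \<le> norm x" for x
      using LIMSEQ_le_const2[OF tendsto_norm[OF Y]] bd by blast
    show "inner (Y x) z = inner x (Y z)" for x z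
    proof (rule LIMSEQ_unique)
      show "(\<lambda>n. inner (y n x) z) \<longlonglongrightarrow> inner (Y x) z" by (intro tendsto_intros Y)
      show "(\<lambda>n. inner (y n x) z) \<longlonglongrightarrow> inner x (Y z)"
        unfolding nonneg_poly_symmetric[OF poly A(1) A(3)] by (intro tendsto_intros Y)
    qed
    show "2 *\<^sub>R Y x = A x + Y (Y x)" for x
    proof (rule LIMSEQ_unique)
      show "(\<lambda>n. 2 *\<^sub>R y (Suc n) x) \<longlonglongrightarrow> 2 *\<^sub>R Y x"
        using Y[of x] by (intro tendsto_intros LIMSEQ_Suc)
      show "(\<lambda>n. 2 *\<^sub>R y (Suc n) x) \<longlonglongrightarrow> A x + Y (Y x)"
        unfolding yS using tendsto_add[OF tendsto_const[of "A x"] YY[of x]] by simp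
    qed
    show "B (Y x) = Y (B x)" if B: "bounded_linear B" "\<And>x. B (A x) = A (B x)" for B x
    proof (rule LIMSEQ_unique)
      show "(\<lambda>n. B (y n x)) \<longlonglongrightarrow> B (Y x)" by (rule bounded_linear.tendsto[OF B(1) Y])
      show "(\<lambda>n. B (y n x)) \<longlonglongrightarrow> Y (B x)"
        unfolding nonneg_poly_commute[OF poly bounded_linear.linear[OF B(1)] B(2)] by (rule Y)
    qed
  qed
qed

text \<open>Scaling by a bound \<open>b\<close> of \<open>S\<close> makes \<open>A = 1 - S/b\<close>
  a semidefinite contraction. Its fixed point satisfies
  \<open>(1 - Y)\<^sup>2 = 1 - A = S/b\<close>, so \<open>sqrt b\<close> times \<open>1 - Y\<close>
  is a root. The commutation clause later yields both scalar linearity and uniqueness.\<close>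

lemma semidefinite_sqrt_ex:
  fixes S :: "'a::{real_inner, complete_space} \<Rightarrow> 'a"
  assumes S: "bounded_linear S" "\<And>x y. inner (S x) y = inner x (S y)" "\<And>x. 0 \<le> inner (S x) x"
  obtains R where "bounded_linear R" "\<And>x y. inner (R x) y = inner x (R y)"
    "\<And>x. 0 \<le> inner (R x) x" "\<And>x. R (R x) = S x"
    "\<And>B x. bounded_linear B \<Longrightarrow> (\<And>x. B (S x) = S (B x)) \<Longrightarrow> B (R x) = R (B x)"
proof -
  obtain b where b: "b > 0" "\<And>x. norm (S x) \<le> norm x * b"
    using bounded_linear.pos_bounded[OF S(1)] by blast
  note linS = bounded_linear.linear[OF S(1)]
  define A where "A x = x - (1/b) *\<^sub>R S x" for x
  have linA: "linear A"
    unfolding A_def by (intro linear_compose_sub linear_compose_scale_right linear_id linS linear_ident)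
  have symA: "inner (A x) y = inner x (A y)" for x y
    by (simp add: A_def inner_diff S(2))
  have Sb: "inner (S x) x \<le> b * (norm x)\<^sup>2" for x
  proof -
    have "inner (S x) x \<le> norm (S x) * norm x" by (rule norm_cauchy_schwarz)
    also have "\<dots> \<le> (norm x * b) * norm x" using b by (intro mult_right_mono) auto
    finally show ?thesis by (simp add: power2_eq_square mult_ac)
  qed
  have A0: "0 \<le> inner (A x) x" for x
    using Sb[of x] b by (simp add: A_def inner_diff power2_norm_eq_inner field_simps)
  have A1: "inner (A x) x \<le> (norm x)\<^sup>2" for x
    using S(3)[of x] b by (simp add: A_def inner_diff power2_norm_eq_inner)
  have normA: "norm (A x) \<le> norm x" for x
    by (rule semidefinite_contraction[OF linA symA A0 A1])
  obtain Y where Y: "linear Y" "\<And>x. norm (Y x) \<le> norm x"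
    "\<And>x y. inner (Y x) y = inner x (Y y)"
    "\<And>x. 2 *\<^sub>R Y x = A x + Y (Y x)"
    "\<And>B x. bounded_linear B \<Longrightarrow> (\<And>x. B (A x) = A (B x)) \<Longrightarrow> B (Y x) = Y (B x)"
    using contraction_fixed_point[OF linA normA symA] by blast
  define R where "R x = sqrt b *\<^sub>R (x - Y x)" for x
  have blY: "bounded_linear Y"
    using Y(1,2) by (intro bounded_linear.intro bounded_linear_axioms.intro)
      (auto intro: exI[of _ 1])
  show ?thesis
  proof
    show "bounded_linear R"
      unfolding R_def by (intro bounded_linear_const_scaleR bounded_linear_sub bounded_linear_ident blY)
    show "inner (R x) y = inner x (R y)" for x y
      by (simp add: R_def inner_diff Y(3))
    show "0 \<le> inner (R x) x" for x
    proof -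
      have "inner (Y x) x \<le> norm (Y x) * norm x" by (rule norm_cauchy_schwarz)
      also have "\<dots> \<le> norm x * norm x" using Y(2) by (intro mult_right_mono) auto
      finally have "inner (Y x) x \<le> inner x x" by (simp add: power2_norm_eq_inner[symmetric] power2_eq_square)
      then show ?thesis using b by (simp add: R_def inner_diff)
    qed
    show "R (R x) = S x" for x
    proof -
      have "R (R x) = b *\<^sub>R (x - (2 *\<^sub>R Y x - Y (Y x)))"
        using b by (simp add: R_def linear_diff[OF Y(1)] linear_scale[OF Y(1)] scaleR_2
            flip: scaleR_diff_right)
      also have "\<dots> = S x" using b by (simp add: Y(4) A_def)
      finally show ?thesis .
    qed
    show "B (R x) = R (B x)" if B: "bounded_linear B" "\<And>x. B (S x) = S (B x)" for B x
    proof -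
      note lB = bounded_linear.linear[OF B(1)]
      have "B (A x) = A (B x)" for x
        by (simp add: A_def linear_diff[OF lB] linear_scale[OF lB] B(2))
      then show ?thesis using Y(5)[OF B(1)]
        by (simp add: R_def linear_diff[OF lB] linear_scale[OF lB])
    qed
  qed
qed

text \<open>By commutation, \<open>R + Q\<close> maps \<open>y = R x - Q x\<close> to the difference
  of the squares, which is 0. Both nonnegative forms then vanish at \<open>y\<close>, so
  \<open>R y = Q y = 0\<close>, and symmetry gives \<open>inner y y = 0\<close>.\<close>

lemma semidefinite_sqrt_unique:
  fixes R Q :: "'a::real_inner \<Rightarrow> 'a"
  assumes R: "linear R" "\<And>x y. inner (R x) y = inner x (R y)" "\<And>x. 0 \<le> inner (R x) x"
    and Q: "linear Q" "\<And>x y. inner (Q x) y = inner x (Q y)" "\<And>x. 0 \<le> inner (Q x) x"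
    and sq: "\<And>x. R (R x) = Q (Q x)" and comm: "\<And>x. Q (R x) = R (Q x)"
  shows "R = Q"
proof
  fix x
  define y where "y = R x - Q x"
  have "R y + Q y = 0"
    by (simp add: y_def linear_diff[OF R(1)] linear_diff[OF Q(1)] sq comm)
  then have "inner (R y) y + inner (Q y) y = 0" by (metis inner_add_left inner_zero_left)
  then have "inner (R y) y = 0" "inner (Q y) y = 0" using R(3)[of y] Q(3)[of y] by linarith+
  then have "R y = 0" "Q y = 0" using semidefinite_eq_zero R Q by blast+
  then have "inner y y = 0"
    unfolding y_def by (simp add: inner_diff_left R(2) Q(2))
  then show "R x = Q x" by (simp add: y_def)
qed

section \<open>Hilbert spaces over a scalar field\<close>

lemma conj_zero [simp]: "conj (0::'k::scalar_field) = 0"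
  using conj_add[of "0::'k" 0] by simp

text \<open>Solves the class axiom \<open>mult_conj\<close> for \<open>conj a\<close>;
  multiplicativity, the values on reals and involutivity are all read off from this formula.\<close>

lemma conj_eq_divide:
  fixes a :: "'k::scalar_field"
  assumes "a \<noteq> 0"
  shows "conj a = of_real ((norm a)\<^sup>2) / a"
  using mult_conj[of a] assms by (simp add: field_simps scaleR_conv_of_real)

lemma conj_mult: "conj (a * b :: 'k::scalar_field) = conj a * conj b"
  by (cases "a = 0 \<or> b = 0") (auto simp: conj_eq_divide norm_mult power_mult_distrib)

lemma conj_of_real [simp]: "conj (of_real r :: 'k::scalar_field) = of_real r"
  by (cases "r = 0") (simp_all add: conj_eq_divide power2_eq_square)

lemma conj_conj [simp]: "conj (conj a :: 'k::scalar_field) = a"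
proof (cases "a = 0")
  case False
  then have "norm (conj a) = norm a"
    by (simp add: conj_eq_divide norm_divide power2_eq_square norm_mult)
  moreover have "conj a \<noteq> 0" using False by (simp add: conj_eq_divide)
  ultimately have "conj (conj a) = of_real ((norm a)\<^sup>2) / conj a" by (simp add: conj_eq_divide)
  then show ?thesis using False by (simp add: conj_eq_divide[OF False])
qed simp

context hilbert_space
begin

section \<open>The field-valued inner product and its real part\<close>

lemma ip_add_right: "ip x (y + z) = ip x y + ip x z"
  by (metis conj_add ip_add_left ip_commute)

lemma ip_smul_right: "ip x (smul c y) = conj c * ip x y"
  by (metis conj_mult ip_commute ip_smul_left)

lemma ip_diff_left: "ip (x - y) z = ip x z - ip y z"
  by (metis add_diff_cancel diff_add_cancel ip_add_left)

text \<open>Polarization: the square of the norm of \<open>x + y\<close> is expanded once with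
  \<open>ip\<close> and once with \<open>inner\<close>. It is the bridge between the two
  products.\<close>

lemma ip_add_ip_commuted: "ip x y + ip y x = of_real (2 * inner x y)"
proof -
  have "ip (x + y) (x + y) = ip x x + (ip x y + ip y x) + ip y y"
    by (simp add: ip_add_left ip_add_right)
  then show ?thesis by (simp add: ip_self norm_add_square)
qed

lemma inner_eq_if_ip_eq:
  assumes "ip x y = ip u w"
  shows "inner x y = inner u w"
proof -
  have "ip y x = ip w u" by (metis assms ip_commute)
  then have "of_real (2 * inner x y) = (of_real (2 * inner u w) :: 'k)"
    using assms by (simp only: ip_add_ip_commuted[symmetric])
  then show ?thesis by (simp only: of_real_eq_iff)
qed

lemma inner_smul_left: "inner (smul c x) y = inner x (smul (conj c) y)"
  by (rule inner_eq_if_ip_eq) (simp add: ip_smul_left ip_smul_right)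

text \<open>With \<open>c\<close> the conjugate of the difference \<open>d\<close> of the two inner products, the hypothesis says
  \<open>2 \<bar>d\<bar>\<^sup>2 = 0\<close>.\<close>
lemma ip_eqI:
  assumes "\<And>c. inner (smul c x) y = inner (smul c u) w"
  shows "ip x y = ip u w"
proof -
  define d where "d = ip x y - ip u w"
  have "of_real (2 * inner (smul c x) y) - (of_real (2 * inner (smul c u) w) :: 'k) = c * d + conj (c * d)" for c
  proof -
    have "ip (smul c x) y = c * d + ip (smul c u) w"
      by (simp add: ip_smul_left d_def algebra_simps)
    moreover from this have "ip y (smul c x) = conj (c * d) + ip w (smul c u)"
      by (metis conj_add ip_commute)
    ultimately show ?thesis unfolding ip_add_ip_commuted[symmetric] by simp
  qed
  then have "conj d * d + conj (conj d * d) = 0" using assms by simp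
  moreover have "conj d * d = of_real ((norm d)\<^sup>2)"
    using mult_conj[of d] by (simp add: scaleR_conv_of_real mult.commute)
  ultimately have "(of_real ((norm d)\<^sup>2) :: 'k) + of_real ((norm d)\<^sup>2) = 0"
    by (simp only: conj_of_real)
  then have "d = 0" by (simp flip: of_real_add)
  then show ?thesis by (simp add: d_def)
qed

lemma norm_smul: "norm (smul c x) = norm c * norm x"
proof -
  have "of_real ((norm (smul c x))\<^sup>2) = (c * conj c) * ip x x"
    unfolding ip_self[symmetric] by (simp add: ip_smul_left ip_smul_right)
  also have "\<dots> = (of_real ((norm c * norm x)\<^sup>2) :: 'k)"
    by (simp add: mult_conj ip_self scaleR_conv_of_real power_mult_distrib)
  finally show ?thesis by (simp only: of_real_eq_iff power2_eq_iff_nonneg norm_ge_zero mult_nonneg_nonneg)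
qed

lemma smul_scaleR: "smul c (r *\<^sub>R x) = r *\<^sub>R smul c x"
  by (metis scale_left_commute smul_of_real)

lemma bounded_linear_smul: "bounded_linear (smul c)"
  by (rule bounded_linear_intro[where K = "norm c"])
    (simp_all add: scale_right_distrib smul_scaleR norm_smul)

lemma real_subspace: "subspace U \<Longrightarrow> real_vector.subspace U"
  unfolding subspace_def real_vector.subspace_def by (metis smul_of_real)

section \<open>Bounded and positive operators over the scalar field\<close>

lemma ip_symmetricI:
  assumes "\<And>x y. inner (T x) y = inner x (T y)" "\<And>c x. T (smul c x) = smul c (T x)"
  shows "ip (T x) y = ip x (T y)"
  by (rule ip_eqI) (metis assms)

lemma bounded_operatorD:
  assumes "bounded_operator smul T"
  shows "bounded_linear T" "T (smul c x) = smul c (T x)"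
  using assms by (auto simp: bounded_operator_def Vector_Spaces.linear_iff)

lemma bounded_operatorI:
  assumes "bounded_linear T" "\<And>c x. T (smul c x) = smul c (T x)"
  shows "bounded_operator smul T"
  unfolding bounded_operator_def
proof
  show "Vector_Spaces.linear smul smul T"
    using assms linear_add[OF bounded_linear.linear[OF assms(1)]]
    by (simp add: Vector_Spaces.linear_iff vector_space_axioms)
qed fact

lemma positive_operatorI:
  assumes "bounded_linear T" "\<And>c x. T (smul c x) = smul c (T x)"
    and "\<And>x y. inner (T x) y = inner x (T y)" "\<And>x. 0 \<le> inner (T x) x"
  shows "positive_operator smul ip T"
proof -
  have sym: "ip (T x) y = ip x (T y)" for x y using ip_symmetricI assms by blast
  have "ip (T x) x = of_real (inner (T x) x)" for x
  proof -
    have "2 * ip (T x) x = 2 * of_real (inner (T x) x)"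
      using ip_add_ip_commuted[of "T x" x] sym[of x x] by simp
    then show ?thesis by simp
  qed
  then show ?thesis
    unfolding positive_operator_def using sym assms bounded_operatorI by blast
qed

lemma positive_operatorD:
  assumes "positive_operator smul ip T"
  shows "bounded_linear T" "T (smul c x) = smul c (T x)"
    "inner (T x) y = inner x (T y)" "0 \<le> inner (T x) x"
proof -
  have T: "bounded_operator smul T" "\<And>x y. ip (T x) y = ip x (T y)"
    using assms by (auto simp: positive_operator_def)
  show "bounded_linear T" "T (smul c x) = smul c (T x)" using bounded_operatorD T by blast+
  show "inner (T x) y = inner x (T y)" using inner_eq_if_ip_eq T(2) by blast
  obtain r where r: "r \<ge> 0" "ip (T x) x = of_real r"
    using assms unfolding positive_operator_def by blast
  moreover from r have "ip x (T x) = of_real r" using T(2) by simp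
  ultimately have "of_real (2 * inner (T x) x) = (of_real (2 * r) :: 'k)"
    unfolding ip_add_ip_commuted[symmetric] by simp
  then show "0 \<le> inner (T x) x" using \<open>r \<ge> 0\<close> by (simp only: of_real_eq_iff)
qed

text \<open>The root from the real theory commutes with each \<open>smul c\<close> because
  \<open>S\<close> does, so it is linear over the scalar field. With uniqueness, this settles the
  definite description in \<open>positive_sqrt\<close>.\<close>

lemma positive_sqrt:
  assumes "positive_operator smul ip S"
  shows "positive_operator smul ip (positive_sqrt smul ip S)"
    and "positive_sqrt smul ip S (positive_sqrt smul ip S x) = S x"
proof -
  note S = positive_operatorD[OF assms]
  obtain R where R: "bounded_linear R" "\<And>x y. inner (R x) y = inner x (R y)"
    "\<And>x. 0 \<le> inner (R x) x" "\<And>x. R (R x) = S x"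
    "\<And>B x. bounded_linear B \<Longrightarrow> (\<And>x. B (S x) = S (B x)) \<Longrightarrow> B (R x) = R (B x)"
    using semidefinite_sqrt_ex[OF S(1,3,4)] by blast
  have "R (smul c x) = smul c (R x)" for c x
    using R(5)[OF bounded_linear_smul] S(2) by metis
  then have pos: "positive_operator smul ip R" using R positive_operatorI by blast
  have "positive_sqrt smul ip S = R" unfolding positive_sqrt_def
  proof (rule the_equality)
    show "positive_operator smul ip R \<and> R \<circ> R = S" using pos R(4) by auto
    fix Q assume Q: "positive_operator smul ip Q \<and> Q \<circ> Q = S"
    then have QQ: "Q (Q x) = S x" for x by auto
    have Q': "bounded_linear Q" "\<And>x y. inner (Q x) y = inner x (Q y)" "\<And>x. 0 \<le> inner (Q x) x"
      using Q positive_operatorD by blast+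
    have "R = Q"
    proof (rule semidefinite_sqrt_unique[OF _ R(2,3) _ Q'(2,3)])
      show "linear R" "linear Q" using R Q' bounded_linear.linear by blast+
      show "R (R x) = Q (Q x)" for x by (simp add: QQ R)
      \<comment> \<open>Any competitor \<open>Q\<close> commutes with its own square
        \<open>S\<close>, hence with \<open>R\<close>.\<close>
      show "Q (R x) = R (Q x)" for x using R(5)[OF Q'(1)] QQ by metis
    qed
    then show "Q = R" ..
  qed
  then show "positive_operator smul ip (positive_sqrt smul ip S)"
    and "positive_sqrt smul ip S (positive_sqrt smul ip S x) = S x"
    using pos R(4) by auto
qed

text \<open>The adjoint for \<open>inner\<close> is also one for \<open>ip\<close>, since
  \<open>T\<close> commutes with scalars; it is unique because \<open>inner\<close> alone already
  determines it.\<close>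

lemma bounded_linear_hilbert_adjoint:
  assumes "bounded_operator smul T"
  shows "bounded_linear (hilbert_adjoint ip T)"
proof -
  note T = bounded_operatorD[OF assms]
  obtain T' where T': "bounded_linear T'" "\<And>x y. inner (T x) y = inner x (T' y)"
    using bounded_adjoint_ex[OF T(1)] by blast
  have "hilbert_adjoint ip T = T'" unfolding hilbert_adjoint_def
  proof (rule the_equality)
    show "\<forall>x y. ip (T x) y = ip x (T' y)"
      by (intro allI ip_eqI) (metis T(2) T'(2))
    fix U assume U: "\<forall>x y. ip (T x) y = ip x (U y)"
    have "inner x (U y) = inner x (T' y)" for x y
      using U inner_eq_if_ip_eq T'(2) by metis
    then show "U = T'" by (metis ext vector_eq_ldot)
  qed
  with T' show ?thesis by simp
qed

section \<open>Orthogonal projections over the scalar field\<close>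

lemma orth_proj_eqI:
  assumes "subspace U" "p \<in> U" "\<And>w. w \<in> U \<Longrightarrow> ip (f - p) w = 0"
  shows "orth_proj ip U f = p"
  unfolding orth_proj_def
proof (rule the_equality)
  fix q assume q: "q \<in> U \<and> (\<forall>w\<in>U. ip (f - q) w = 0)"
  then have "q - p \<in> U" using assms subspace_diff by blast
  then have "ip (f - p) (q - p) - ip (f - q) (q - p) = 0" using q assms by simp
  then have "ip (q - p) (q - p) = 0" by (simp flip: ip_diff_left)
  then show "q = p" by (simp add: ip_self)
qed (use assms in blast)

lemma
  assumes U: "subspace U" "closed U"
  shows orth_proj_mem: "orth_proj ip U f \<in> U"
    and orth_proj_ip: "w \<in> U \<Longrightarrow> ip (f - orth_proj ip U f) w = 0"
proof -
  obtain p where p: "p \<in> U" "\<And>w. w \<in> U \<Longrightarrow> inner (f - p) w = 0"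
    using closed_subspace_projection_ex[OF real_subspace[OF U(1)] U(2)] by blast
  \<comment> \<open>The scalar \<open>c\<close> moves to \<open>w\<close> as its conjugate, and
    \<open>U\<close> is closed under scalars, so real orthogonality to all of \<open>U\<close>
    suffices.\<close>
  have "ip (f - p) w = ip 0 w" if "w \<in> U" for w
    by (rule ip_eqI) (simp add: inner_smul_left p that subspace_scale[OF U(1)])
  moreover have "ip 0 w = 0" for w using ip_smul_left[of 0 w w] by simp
  ultimately have *: "\<And>w. w \<in> U \<Longrightarrow> ip (f - p) w = 0" by simp
  then have "orth_proj ip U f = p" using orth_proj_eqI U p by blast
  then show "orth_proj ip U f \<in> U" "w \<in> U \<Longrightarrow> ip (f - orth_proj ip U f) w = 0"
    using p * by auto
qed

lemma orth_proj_add: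
  assumes U: "subspace U" "closed U"
  shows "orth_proj ip U (f + g) = orth_proj ip U f + orth_proj ip U g"
proof (rule orth_proj_eqI[OF U(1)])
  show "orth_proj ip U f + orth_proj ip U g \<in> U"
    using U orth_proj_mem subspace_add by blast
  fix w assume "w \<in> U"
  then show "ip (f + g - (orth_proj ip U f + orth_proj ip U g)) w = 0"
    using orth_proj_ip[OF U, of w f] orth_proj_ip[OF U, of w g]
    by (simp add: add_diff_add ip_add_left)
qed

lemma orth_proj_smul:
  assumes U: "subspace U" "closed U"
  shows "orth_proj ip U (smul c f) = smul c (orth_proj ip U f)"
proof (rule orth_proj_eqI[OF U(1)])
  show "smul c (orth_proj ip U f) \<in> U"
    using U orth_proj_mem subspace_scale by blast
  fix w assume "w \<in> U"
  then show "ip (smul c f - smul c (orth_proj ip U f)) w = 0"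
    using orth_proj_ip[OF U, of w f]
    by (simp add: ip_smul_left flip: scale_right_diff_distrib)
qed

text \<open>The residual of \<open>g\<close> is orthogonal to \<open>U\<close>. The right-hand side
  is symmetric in \<open>f\<close> and \<open>g\<close> and becomes a squared norm for
  \<open>f = g\<close>.\<close>

lemma inner_orth_proj:
  assumes U: "subspace U" "closed U"
  shows "inner (orth_proj ip U f) g = inner (orth_proj ip U f) (orth_proj ip U g)"
proof -
  have "of_real (2 * inner (g - orth_proj ip U g) (orth_proj ip U f)) = (0 :: 'k)"
    unfolding ip_add_ip_commuted[symmetric]
    using orth_proj_ip[OF U orth_proj_mem[OF U]]
    by (subst (2) ip_commute) simp
  then have "inner (g - orth_proj ip U g) (orth_proj ip U f) = 0" by simp
  then show ?thesis by (simp add: inner_diff inner_commute)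
qed

end

section \<open>Fusion frame operators\<close>

lemma has_sum_inner_left:
  "(f has_sum s) A \<Longrightarrow> ((\<lambda>i. inner (f i) g) has_sum inner s g) A"
  by (rule has_sum_bounded_linear[OF bounded_linear_inner_left])

context hilbert_space
begin

context
  fixes I :: "'i set" and W :: "'i \<Rightarrow> 'a set" and v :: "'i \<Rightarrow> real"
  assumes bessel: "fusion_bessel smul ip I W v"
begin

lemma
  assumes "i \<in> I"
  shows bessel_subspace: "subspace (W i)" and bessel_closed: "closed (W i)"
  using bessel assms by (auto simp: fusion_bessel_def weighted_closed_subspaces_def)

text \<open>The Bessel bound, applied to a finite partial sum \<open>u\<close> itself, controls the
  norm of \<open>u\<close> by the corresponding partial sum of the Bessel series of
  \<open>f\<close>; the Cauchy criterion then applies.\<close>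

lemma fusion_frame_operator_has_sum:
  "((\<lambda>i. (v i)\<^sup>2 *\<^sub>R orth_proj ip (W i) f) has_sum fusion_frame_operator ip I W v f) I"
proof -
  obtain B where B: "B > 0"
    and summable: "\<And>f. (\<lambda>i. (v i)\<^sup>2 * (norm (orth_proj ip (W i) f))\<^sup>2) summable_on I"
    and le: "\<And>f. (\<Sum>\<^sub>\<infinity>i\<in>I. (v i)\<^sup>2 * (norm (orth_proj ip (W i) f))\<^sup>2) \<le> B * (norm f)\<^sup>2"
    using bessel unfolding fusion_bessel_def by blast
  have "(\<lambda>i. (v i)\<^sup>2 *\<^sub>R orth_proj ip (W i) f) summable_on I"
  proof (rule summable_on_if_norm_sum_square_le[OF summable[of f] _ B])
    fix F assume F: "finite F" "F \<subseteq> I"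
    let ?P = "\<lambda>i. orth_proj ip (W i)"
    define u where "u = (\<Sum>i\<in>F. (v i)\<^sup>2 *\<^sub>R ?P i f)"
    have "(\<Sum>i\<in>F. (v i)\<^sup>2 * (norm (?P i u))\<^sup>2) \<le> (\<Sum>\<^sub>\<infinity>i\<in>I. (v i)\<^sup>2 * (norm (?P i u))\<^sup>2)"
      using F summable by (intro finite_sum_le_infsum) auto
    then have u_le: "(\<Sum>i\<in>F. (v i)\<^sup>2 * (norm (?P i u))\<^sup>2) \<le> B * (norm u)\<^sup>2"
      using le order_trans by blast
    \<comment> \<open>The factor \<open>2 * B\<close> prepares Young's inequality: its second term
      is at most \<open>B * (norm u)\<^sup>2\<close> by the Bessel bound, which absorbs half of the
      left-hand side.\<close>
    have "2 * (B * (norm u)\<^sup>2) = (\<Sum>i\<in>F. (v i)\<^sup>2 * (2 * B * inner (?P i f) u))"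
      unfolding power2_norm_eq_inner
      by (subst (1) u_def) (simp add: inner_sum_left sum_distrib_left mult_ac)
    also have "\<dots> = (\<Sum>i\<in>F. (v i)\<^sup>2 * (2 * inner (B *\<^sub>R ?P i f) (?P i u)))"
      using F inner_orth_proj[OF bessel_subspace bessel_closed, of _ f u]
      by (intro sum.cong) auto
    also have "\<dots> \<le> (\<Sum>i\<in>F. (v i)\<^sup>2 * (B\<^sup>2 * (norm (?P i f))\<^sup>2 + (norm (?P i u))\<^sup>2))"
    proof (intro sum_mono mult_left_mono)
      fix i
      have "0 \<le> (norm (B *\<^sub>R ?P i f - ?P i u))\<^sup>2" by simp
      then show "2 * inner (B *\<^sub>R ?P i f) (?P i u) \<le> B\<^sup>2 * (norm (?P i f))\<^sup>2 + (norm (?P i u))\<^sup>2"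
        unfolding power2_norm_eq_inner
        by (simp add: inner_diff inner_commute power2_eq_square algebra_simps)
    qed simp
    also have "\<dots> = B * (B * (\<Sum>i\<in>F. (v i)\<^sup>2 * (norm (?P i f))\<^sup>2)) + (\<Sum>i\<in>F. (v i)\<^sup>2 * (norm (?P i u))\<^sup>2)"
      by (simp add: distrib_left sum.distrib sum_distrib_left power2_eq_square mult_ac)
    finally have "B * (norm u)\<^sup>2 \<le> B * (B * (\<Sum>i\<in>F. (v i)\<^sup>2 * (norm (?P i f))\<^sup>2))"
      using u_le by linarith
    then show "(norm u)\<^sup>2 \<le> B * (\<Sum>i\<in>F. (v i)\<^sup>2 * (norm (?P i f))\<^sup>2)"
      using B by simp
  qed simp
  then show ?thesis unfolding fusion_frame_operator_def by (rule has_sum_infsum)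
qed

lemma inner_fusion_frame_operator_has_sum:
  "((\<lambda>i. (v i)\<^sup>2 * inner (orth_proj ip (W i) f) (orth_proj ip (W i) g))
    has_sum inner (fusion_frame_operator ip I W v f) g) I"
proof -
  have "((\<lambda>i. inner ((v i)\<^sup>2 *\<^sub>R orth_proj ip (W i) f) g)
      has_sum inner (fusion_frame_operator ip I W v f) g) I"
    by (rule has_sum_inner_left[OF fusion_frame_operator_has_sum])
  moreover have "inner ((v i)\<^sup>2 *\<^sub>R orth_proj ip (W i) f) g
      = (v i)\<^sup>2 * inner (orth_proj ip (W i) f) (orth_proj ip (W i) g)" if "i \<in> I" for i
    using inner_orth_proj[OF bessel_subspace bessel_closed, OF that that, of f g] by simp
  ultimately show ?thesis by (subst (asm) has_sum_cong)
qed

lemma fusion_frame_operator_quadratic_form: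
  "inner (fusion_frame_operator ip I W v f) f = (\<Sum>\<^sub>\<infinity>i\<in>I. (v i)\<^sup>2 * (norm (orth_proj ip (W i) f))\<^sup>2)"
  using inner_fusion_frame_operator_has_sum[of f f, THEN infsumI]
  by (simp add: power2_norm_eq_inner)

lemma positive_operator_fusion_frame_operator:
  "positive_operator smul ip (fusion_frame_operator ip I W v)"
proof -
  let ?S = "fusion_frame_operator ip I W v"
  have add: "?S (f + g) = ?S f + ?S g" for f g
  proof (rule has_sum_unique[OF fusion_frame_operator_has_sum])
    show "((\<lambda>i. (v i)\<^sup>2 *\<^sub>R orth_proj ip (W i) (f + g)) has_sum ?S f + ?S g) I"
      using has_sum_add[OF fusion_frame_operator_has_sum[of f] fusion_frame_operator_has_sum[of g]]
      by (rule has_sum_cong[THEN iffD1, rotated])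
        (simp add: orth_proj_add bessel_subspace bessel_closed scaleR_add_right)
  qed
  have smul: "?S (smul c f) = smul c (?S f)" for c f
  proof (rule has_sum_unique[OF fusion_frame_operator_has_sum])
    show "((\<lambda>i. (v i)\<^sup>2 *\<^sub>R orth_proj ip (W i) (smul c f)) has_sum smul c (?S f)) I"
      using has_sum_bounded_linear[OF bounded_linear_smul fusion_frame_operator_has_sum]
      by (rule has_sum_cong[THEN iffD1, rotated])
        (simp add: orth_proj_smul bessel_subspace bessel_closed smul_scaleR)
  qed
  have scaleR: "?S (r *\<^sub>R f) = r *\<^sub>R ?S f" for r f
    using smul[of "of_real r"] by (simp add: smul_of_real)
  have sym: "inner (?S f) g = inner f (?S g)" for f g
    using has_sum_unique[OF inner_fusion_frame_operator_has_sum[of f g]]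
      inner_fusion_frame_operator_has_sum[of g f] by (simp add: inner_commute)
  have nonneg: "0 \<le> inner (?S f) f" for f
    unfolding fusion_frame_operator_quadratic_form by (intro infsum_nonneg) simp
  obtain B where B: "B > 0" "\<And>f. inner (?S f) f \<le> B * (norm f)\<^sup>2"
    using bessel unfolding fusion_bessel_def fusion_frame_operator_quadratic_form by blast
  \<comment> \<open>The Bessel bound says that the form of \<open>?S\<close> scaled by
    \<open>1/B\<close> is at most the squared norm, so the scaled operator is a contraction.\<close>
  have "norm ((1/B) *\<^sub>R ?S f) \<le> norm f" for f
  proof (rule semidefinite_contraction)
    show "linear (\<lambda>x. (1/B) *\<^sub>R ?S x)"
      by (intro linearI) (simp_all add: add scaleR scaleR_add_right)
    show "inner ((1/B) *\<^sub>R ?S x) x \<le> (norm x)\<^sup>2" for x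
      using B by (simp add: field_simps)
  qed (use B sym nonneg in auto)
  then have "norm (?S f) \<le> norm f * B" for f using B by (simp add: field_simps)
  then have "bounded_linear ?S" by (intro bounded_linear_intro add scaleR)
  then show ?thesis using smul sym nonneg by (rule positive_operatorI)
qed

lemma norm_sqrt_fusion_frame_operator:
  "(norm (positive_sqrt smul ip (fusion_frame_operator ip I W v) f))\<^sup>2
    = (\<Sum>\<^sub>\<infinity>i\<in>I. (v i)\<^sup>2 * (norm (orth_proj ip (W i) f))\<^sup>2)"
proof -
  note S = positive_operator_fusion_frame_operator
  show ?thesis
    by (simp add: power2_norm_eq_inner[of "positive_sqrt _ _ _ _"] positive_sqrt(2)[OF S]
        positive_operatorD(3)[OF positive_sqrt(1)[OF S]] inner_commute
        flip: fusion_frame_operator_quadratic_form)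
qed

end

end

theorem theorem4p2:
  fixes smul :: "'k::scalar_field \<Rightarrow> 'a::{real_inner, complete_space} \<Rightarrow> 'a"
    and ip :: "'a \<Rightarrow> 'a \<Rightarrow> 'k"
    and I :: "'i set"
    and W :: "'i \<Rightarrow> 'a set"
    and v :: "'i \<Rightarrow> real"
    and K :: "'a \<Rightarrow> 'a"
  assumes "hilbert_space smul ip"
    and "separable_space (euclidean :: 'a topology)"
    and "countable I"
    and "fusion_bessel smul ip I W v"
    and "bounded_operator smul K"
  defines "S \<equiv> fusion_frame_operator ip I W v"
  shows "K_fusion_frame smul ip K I W v \<longleftrightarrow>
    quotient_well_defined (hilbert_adjoint ip K) (positive_sqrt smul ip S) \<and>
    bounded_map_on (range (positive_sqrt smul ip S))
      (quotient_operator (hilbert_adjoint ip K) (positive_sqrt smul ip S))"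
proof -
  interpret hilbert_space smul ip by fact
  define R where "R = positive_sqrt smul ip S"
  define L where "L = hilbert_adjoint ip K"
  have blR: "bounded_linear R"
    unfolding R_def S_def
    using positive_sqrt(1)[OF positive_operator_fusion_frame_operator] positive_operatorD(1) assms(4)
    by blast
  have blL: "bounded_linear L"
    unfolding L_def by (rule bounded_linear_hilbert_adjoint) fact
  have normR: "(\<Sum>\<^sub>\<infinity>i\<in>I. (v i)\<^sup>2 * (norm (orth_proj ip (W i) f))\<^sup>2) = (norm (R f))\<^sup>2" for f
    unfolding R_def S_def using norm_sqrt_fusion_frame_operator[OF assms(4)] by simp
  \<comment> \<open>Summability and the upper bound are supplied by the Bessel assumption, so only
    the lower inequality remains.\<close>
  have frame: "K_fusion_frame smul ip K I W v \<longleftrightarrow> (\<exists>A>0. \<forall>f. A * (norm (L f))\<^sup>2 \<le> (norm (R f))\<^sup>2)"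
    using assms(4) unfolding K_fusion_frame_def fusion_bessel_def normR L_def[symmetric] by blast
  show ?thesis
    unfolding frame R_def[symmetric] L_def[symmetric]
  proof safe
    fix A :: real assume A: "A > 0" "\<forall>f. A * (norm (L f))\<^sup>2 \<le> (norm (R f))\<^sup>2"
    show wd: "quotient_well_defined L R"
      unfolding quotient_well_defined_def null_space_def
    proof safe
      fix f assume "R f = 0"
      then have "A * (norm (L f))\<^sup>2 \<le> 0" using A(2)[rule_format, of f] by simp
      then show "L f = 0" using A(1) by (simp add: mult_le_0_iff)
    qed
    have "norm (L f) \<le> (1 / sqrt A) * norm (R f)" for f
    proof -
      have "sqrt (A * (norm (L f))\<^sup>2) \<le> sqrt ((norm (R f))\<^sup>2)" using A(2) real_sqrt_le_mono by blast
      then show ?thesis using A(1) by (simp add: real_sqrt_mult field_simps)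
    qed
    then show "bounded_map_on (range R) (quotient_operator L R)"
      unfolding bounded_map_on_def
      by (intro exI[of _ "1 / sqrt A"]) (simp add: quotient_operator_apply[OF blL blR wd])
  next
    assume wd: "quotient_well_defined L R" and bd: "bounded_map_on (range R) (quotient_operator L R)"
    obtain C where C: "\<And>f. norm (L f) \<le> C * norm (R f)"
      using bd unfolding bounded_map_on_def by (auto simp: quotient_operator_apply[OF blL blR wd])
    \<comment> \<open>The constant \<open>C\<close> may be zero; adding 1 to its square keeps the
      lower frame bound well defined and positive.\<close>
    have "1 / (C\<^sup>2 + 1) * (norm (L f))\<^sup>2 \<le> (norm (R f))\<^sup>2" for f
    proof -
      have "(norm (L f))\<^sup>2 \<le> (C * norm (R f))\<^sup>2" using C by (intro power_mono) auto
      also have "\<dots> \<le> (C\<^sup>2 + 1) * (norm (R f))\<^sup>2" by (simp add: power_mult_distrib distrib_right)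
      finally show ?thesis by (simp add: add_nonneg_pos pos_divide_le_eq mult.commute)
    qed
    moreover have "1 / (C\<^sup>2 + 1) > 0" by (simp add: add_nonneg_pos)
    ultimately show "\<exists>A>0. \<forall>f. A * (norm (L f))\<^sup>2 \<le> (norm (R f))\<^sup>2" by blast
  qed
qed

end
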